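(* Let $\rho:[1,\infty)\to(0,1]$ be a decreasing bijection. Then for any $p\in\mathbb N$ there exists a function $F\in\mathcal F^{p,\mathrm{cvx}}_\infty$ such that $$\limsup_{n\to\infty}\ \inf_{\mathrm A\in\mathcal A_{\mathrm{zr}}^{(p)}}\frac{n^{\frac{3p+1}{2}}\,\big(F(\mathrm A[F]_n)-F^\star\big)}{\rho(n)}\ \ge\ 1,$$ where $\mathrm A[F]_n=x^{(n+1)}$ denotes the output of $\mathrm A$ on $F$ after $n$ oracle calls.
   Context: $\mathbb N=\{1,2,\dots\}$. $\mathcal H_\infty$ is an infinite-dimensional real Hilbert space with coordinates indexed by $\mathbb N$ with respect to a fixed orthonormal basis (i.e. $\ell^2$). $f^\star:=\inf f$. $\mathbf{dist}(x,S)=\inf_{y\in S}\|x-y\|$, equal to $\infty$ if $S=\emptyset$. Function class: $\mathcal F^{p,\mathrm{cvx}}_\infty$ is the set of convex $f:\mathcal H_\infty\to\mathbb R$ that are $p$ times continuously (Fréchet) differentiable with $\|\nabla^pf(x)-\nabla^pf(y)\|\le\|x-y\|$ for all $x,y$ (operator norm on symmetric $p$-linear forms), with $-1\le f^\star\le f(\mathbf 0)\le1$, $\|\nabla^rf(\mathbf 0)\|\le1$ for all $r\in\{1,\dots,p\}$, and $\mathbf{dist}(\mathbf 0,\arg\min f)\le1$. Support: for a vector $x$, $\operatorname{supp}\{x\}=\{j:x_j\ne0\}$; for a symmetric order-$r$ tensor $T$, $r\ge2$, $\operatorname{supp}\{T\}=\{j:T_{j,j_2,\dots,j_r}\ne0\text{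 for some }j_2,\dots,j_r\}$. Zero-respecting: a sequence $x^{(1)},x^{(2)},\dots$ is $p$th-order zero-respecting with respect to $f$ (differentiable through order $p$) if for each $t\in\mathbb N$, $\operatorname{supp}\{x^{(t)}\}\subseteq\bigcup_{r\in\{1,\dots,p\}}\bigcup_{s<t}\operatorname{supp}\{\nabla^rf(x^{(s)})\}$ (so $x^{(1)}=\mathbf 0$). An algorithm $\mathrm A$ maps an objective $f$ to a sequence of iterates $\mathrm A[f]=\{x^{(t)}\}_{t\ge1}$; $\mathrm A\in\mathcal A_{\mathrm{zr}}^{(p)}$ if for every $f$ differentiable through order $p$ the sequence $\mathrm A[f]$ is $p$th-order zero-respecting with respect to $f$. *)

theory Defs
  imports "HOL-Analysis.Analysis"
begin

text \<open>
  The infinite-dimensional Hilbert space is any type of class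
  \<^class>\<open>real_inner\<close> and \<^class>\<open>complete_space\<close> with an orthonormal basis \<open>e\<close> indexed by
  \<^typ>\<open>nat\<close>. The coordinates of \<open>x\<close> are \<open>x \<bullet> e j\<close>, counted from \<open>j = 0\<close>.
\<close>

definition orthonormal_basis :: "(nat \<Rightarrow> 'a::real_inner) \<Rightarrow> bool" where
  "orthonormal_basis e \<longleftrightarrow>
     (\<forall>i j. e i \<bullet> e j = (if i = j then 1 else 0)) \<and> closure (span (range e)) = UNIV"

text \<open>
  An \<open>r\<close>-linear form is a function on argument lists; only its values on lists of
  length \<open>r\<close> matter.
\<close>

definition bounded_multilinear :: "nat \<Rightarrow> ('a::real_normed_vector list \<Rightarrow> real) \<Rightarrow> bool" where
  "bounded_multilinear r T \<longleftrightarrow>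
     (\<forall>vs i. length vs = r \<and> i < r \<longrightarrow> linear (\<lambda>v. T (vs[i := v]))) \<and>
     (\<exists>C. \<forall>vs. length vs = r \<longrightarrow> \<bar>T vs\<bar> \<le> C * prod_list (map norm vs))"

definition form_norm :: "nat \<Rightarrow> ('a::real_normed_vector list \<Rightarrow> real) \<Rightarrow> real" where
  "form_norm r T = (SUP vs\<in>{vs. length vs = r \<and> (\<forall>v\<in>set vs. norm v \<le> 1)}. \<bar>T vs\<bar>)"

text \<open>
  \<open>nabla r f x [v\<^sub>1, \<dots>, v\<^sub>r]\<close> is the \<open>r\<close>-th derivative of \<open>f\<close> at \<open>x\<close> evaluated at
  \<open>v\<^sub>1, \<dots>, v\<^sub>r\<close>. It is meaningful only for functions satisfying \<open>differentiable_through r\<close>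
  below: there it is the only possible value of the \<open>r\<close>-th Frechet derivative, because
  evaluation at a fixed list of arguments is a bounded linear map on forms.
\<close>

fun nabla :: "nat \<Rightarrow> ('a::real_normed_vector \<Rightarrow> real) \<Rightarrow> 'a \<Rightarrow> 'a list \<Rightarrow> real" where
  "nabla 0 f x vs = f x"
| "nabla (Suc r) f x vs = frechet_derivative (\<lambda>y. nabla r f y (tl vs)) (at x) (hd vs)"

text \<open>
  For each \<open>r < p\<close>, the map \<open>nabla r f\<close> into the bounded \<open>r\<close>-linear forms with the operator
  norm is Frechet differentiable everywhere. This asks for a remainder uniform in the
  arguments \<open>vs\<close>, which the pointwise recursion defining \<^const>\<open>nabla\<close> does not give.
\<close>

definition differentiable_through :: "nat \<Rightarrow> ('a::real_normed_vector \<Rightarrow> real) \<Rightarrow> bool" where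
  "differentiable_through p f \<longleftrightarrow>
     (\<forall>r<p. \<forall>x. bounded_multilinear (Suc r) (nabla (Suc r) f x) \<and>
        ((\<lambda>y. form_norm r (\<lambda>vs. nabla r f y vs - nabla r f x vs - nabla (Suc r) f x ((y - x) # vs))
              / norm (y - x)) \<longlongrightarrow> 0) (at x))"

definition continuously_differentiable_through ::
    "nat \<Rightarrow> ('a::real_normed_vector \<Rightarrow> real) \<Rightarrow> bool" where
  "continuously_differentiable_through p f \<longleftrightarrow> differentiable_through p f \<and>
     (\<forall>x. ((\<lambda>y. form_norm p (\<lambda>vs. nabla p f y vs - nabla p f x vs)) \<longlongrightarrow> 0) (at x))"

definition opt_val :: "('a \<Rightarrow> real) \<Rightarrow> real" where
  "opt_val f = (INF x. f x)"

definition argmin_set :: "('a \<Rightarrow> real) \<Rightarrow> 'a set" where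
  "argmin_set f = {x. is_arg_min f (\<lambda>_. True) x}"

text \<open>Unlike \<^const>\<open>infdist\<close>, this is \<open>\<infinity>\<close> for the empty set.\<close>

definition ext_dist :: "'a::metric_space \<Rightarrow> 'a set \<Rightarrow> ereal" where
  "ext_dist x S = (INF y\<in>S. ereal (dist x y))"

text \<open>
  The conjunct \<^term>\<open>bdd_below (range f)\<close> is part of the condition that the infimum is at
  least \<open>-1\<close>: the real infimum of an unbounded set is unspecified.
\<close>

definition smooth_convex_class :: "nat \<Rightarrow> ('a::real_normed_vector \<Rightarrow> real) set" where
  "smooth_convex_class p = {f.
     convex_on UNIV f \<and>
     continuously_differentiable_through p f \<and>
     (\<forall>x y. form_norm p (\<lambda>vs. nabla p f x vs - nabla p f y vs) \<le> norm (x - y)) \<and>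
     bdd_below (range f) \<and> -1 \<le> opt_val f \<and> opt_val f \<le> f 0 \<and> f 0 \<le> 1 \<and>
     (\<forall>r\<in>{1..p}. form_norm r (nabla r f 0) \<le> 1) \<and>
     ext_dist 0 (argmin_set f) \<le> 1}"

definition supp :: "(nat \<Rightarrow> 'a::real_inner) \<Rightarrow> 'a \<Rightarrow> nat set" where
  "supp e x = {j. x \<bullet> e j \<noteq> 0}"

text \<open>
  The entries of a form \<open>T\<close> are \<open>T [e j\<^sub>1, \<dots>, e j\<^sub>r]\<close>. For \<open>r = 1\<close> the list \<open>js\<close> is empty and
  this is the support of the gradient vector, whose coordinates are \<open>nabla 1 f x [e j]\<close>.
\<close>

definition form_supp :: "(nat \<Rightarrow> 'a) \<Rightarrow> nat \<Rightarrow> ('a list \<Rightarrow> real) \<Rightarrow> nat set" where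
  "form_supp e r T = {j. \<exists>js. length js = r - 1 \<and> T (e j # map e js) \<noteq> 0}"

text \<open>
  Iterates are counted from \<open>0\<close>: \<open>X n\<close> is the point produced after \<open>n\<close> oracle calls, at
  \<open>X 0, \<dots>, X (n - 1)\<close>.
\<close>

definition zero_respecting ::
    "(nat \<Rightarrow> 'a::real_inner) \<Rightarrow> nat \<Rightarrow> ('a \<Rightarrow> real) \<Rightarrow> (nat \<Rightarrow> 'a) \<Rightarrow> bool" where
  "zero_respecting e p f X \<longleftrightarrow>
     (\<forall>t. supp e (X t) \<subseteq> (\<Union>r\<in>{1..p}. \<Union>s\<in>{..<t}. form_supp e r (nabla r f (X s))))"

definition zr_algorithms ::
    "(nat \<Rightarrow> 'a::real_inner) \<Rightarrow> nat \<Rightarrow> (('a \<Rightarrow> real) \<Rightarrow> nat \<Rightarrow> 'a) set" where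
  "zr_algorithms e p = {A. \<forall>f. differentiable_through p f \<longrightarrow> zero_respecting e p f (A f)}"

end

theory Submission
  imports Defs
begin

text \<open>
  Given a point \<open>z\<close> of the unit ball and vectors \<open>u m\<close> satisfying Bessel's inequality, let
  \<open>F x\<close> be the sum over \<open>m\<close> of the Bregman divergences of \<open>\<bar>s\<bar>\<^sup>p\<^sup>+\<^sup>1 / (p + 1)!\<close> from \<open>z \<bullet> u m\<close>
  to \<open>x \<bullet> u m\<close>. All terms are nonnegative and vanish at \<open>z\<close>, so \<open>F\<close> has minimal value \<open>0\<close>,
  and \<open>F\<close> belongs to the class whatever \<open>z\<close> is. The \<open>u m\<close> are taken to be halved differences
  of consecutive basis vectors in infinitely many rows, and along row \<open>b\<close> the coordinates of
  \<open>z\<close> fall linearly to \<open>0\<close> over \<open>k = 3 n\<close> places with slope of order \<open>2\<^sup>-\<^sup>b k\<^sup>-\<^sup>3\<^sup>/\<^sup>2\<close>. The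
  gradient of \<open>F\<close> at \<open>0\<close> then sees only the two ends of the ramp, and each oracle call reveals
  at most one further coordinate from either end. After \<open>n\<close> calls, the middle \<open>n\<close> differences
  still vanish, and their terms alone contribute a constant times
  \<open>n (2\<^sup>-\<^sup>b n\<^sup>-\<^sup>3\<^sup>/\<^sup>2)\<^sup>p\<^sup>+\<^sup>1\<close>. Since \<open>\<rho>\<close> tends to \<open>0\<close>, \<open>n\<close> can be chosen for each \<open>b\<close> so large that
  the factor \<open>2\<^sup>-\<^sup>b\<^sup>(\<^sup>p\<^sup>+\<^sup>1\<^sup>)\<close> is absorbed.
\<close>

section \<open>Derivatives of a power of the absolute value, with Lipschitz and remainder
  bounds\<close>

text \<open>Away from \<open>0\<close> the function is a polynomial up to sign; at \<open>0\<close>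
  the difference quotient is at most \<open>\<bar>h\<bar> ^ (q - 1)\<close>, which tends to
  \<open>0\<close> because \<open>q \<ge> 2\<close>. Carrying the factor \<open>sgn s ^ r\<close>
  closes the family under differentiation without splitting on parity.\<close>

lemma DERIV_sgn_abs_power:
  fixes s :: real
  assumes "q \<ge> 2"
  shows "((\<lambda>s. sgn s ^ r * \<bar>s\<bar> ^ q) has_real_derivative of_nat q * (sgn s ^ Suc r * \<bar>s\<bar> ^ (q - 1))) (at s)"
proof -
  consider "s > 0" | "s < 0" | "s = 0" by linarith
  then show ?thesis
  proof cases
    case 1
    have "((\<lambda>s. s ^ q) has_real_derivative of_nat q * (sgn s ^ Suc r * \<bar>s\<bar> ^ (q - 1))) (at s)"
      using 1 by (auto intro!: derivative_eq_intros)
    then show ?thesis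
      by (rule has_field_derivative_transform_within_open[where S="{0<..}"]) (use 1 in auto)
  next
    case 2
    have "((\<lambda>s. (-1) ^ r * (- s) ^ q) has_real_derivative of_nat q * (sgn s ^ Suc r * \<bar>s\<bar> ^ (q - 1))) (at s)"
      using 2 by (auto intro!: derivative_eq_intros)
    then show ?thesis
      by (rule has_field_derivative_transform_within_open[where S="{..<0}"]) (use 2 in auto)
  next
    case 3
    have lim: "((\<lambda>h::real. \<bar>h\<bar> ^ (q - 1)) \<longlongrightarrow> 0) (at 0)"
      using assms by (auto intro!: tendsto_eq_intros)
    have "((\<lambda>h. (sgn h ^ r * \<bar>h\<bar> ^ q) / h) \<longlongrightarrow> 0) (at (0::real))"
    proof (rule Lim_null_comparison[OF _ lim], rule always_eventually, rule allI)
      fix h :: real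
      obtain k where q: "q = Suc k" using assms by (cases q) auto
      have "\<bar>sgn h\<bar> ^ r \<le> 1" by (rule power_le_one) (auto simp: sgn_real_def)
      then have "\<bar>sgn h\<bar> ^ r * \<bar>h\<bar> ^ k \<le> 1 * \<bar>h\<bar> ^ k" by (intro mult_right_mono) auto
      then show "norm (sgn h ^ r * \<bar>h\<bar> ^ q / h) \<le> \<bar>h\<bar> ^ (q - 1)"
        by (simp add: q abs_mult power_abs)
    qed
    then show ?thesis using 3 assms by (simp add: has_field_derivative_iff power_0_left)
  qed
qed

text \<open>The \<open>r\<close>-th derivative, \<open>r \<le> p\<close>, of \<open>\<bar>s\<bar>\<^sup>p\<^sup>+\<^sup>1 / (p + 1)!\<close>.\<close>

definition pow_deriv :: "nat \<Rightarrow> nat \<Rightarrow> real \<Rightarrow> real" where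
  "pow_deriv p r s = sgn s ^ r * \<bar>s\<bar> ^ (p + 1 - r) / fact (p + 1 - r)"

lemma DERIV_pow_deriv:
  assumes "r < p"
  shows "(pow_deriv p r has_real_derivative pow_deriv p (Suc r) s) (at s)"
proof -
  obtain k where k: "p = Suc (r + k)" using less_imp_Suc_add[OF assms] by auto
  have "(pow_deriv p r has_real_derivative
      of_nat (Suc (Suc k)) * (sgn s ^ Suc r * \<bar>s\<bar> ^ (Suc (Suc k) - 1)) / fact (Suc (Suc k))) (at s)"
    unfolding pow_deriv_def using k
    by (simp del: fact_Suc of_nat_Suc power_Suc)
      (intro DERIV_cdivide, use DERIV_sgn_abs_power[of "Suc (Suc k)" r s] in simp)
  moreover have "of_nat (Suc (Suc k)) * (sgn s ^ Suc r * \<bar>s\<bar> ^ (Suc (Suc k) - 1)) / fact (Suc (Suc k))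
      = pow_deriv p (Suc r) s"
    unfolding pow_deriv_def k fact_Suc[of "Suc k"] of_nat_fact
    using nonzero_mult_divide_mult_cancel_left[OF of_nat_neq_0[of "Suc k", where 'a=real]]
    by (simp del: fact_Suc of_nat_Suc power_Suc)
  ultimately show ?thesis by simp
qed

lemma pow_deriv_0: "r \<le> p \<Longrightarrow> pow_deriv p r 0 = 0"
  by (simp add: pow_deriv_def)

lemma abs_pow_deriv_le:
  assumes "\<bar>s\<bar> \<le> M"
  shows "\<bar>pow_deriv p r s\<bar> \<le> M ^ (p + 1 - r)"
proof -
  have "\<bar>sgn s\<bar> ^ r \<le> 1" by (rule power_le_one) (auto simp: sgn_real_def)
  then have "\<bar>sgn s\<bar> ^ r * \<bar>s\<bar> ^ (p + 1 - r) \<le> 1 * M ^ (p + 1 - r)"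
    using assms by (intro mult_mono power_mono) auto
  then have "\<bar>pow_deriv p r s\<bar> \<le> M ^ (p + 1 - r) / fact (p + 1 - r)"
    unfolding pow_deriv_def by (simp add: abs_mult power_abs divide_right_mono)
  also have "\<dots> \<le> M ^ (p + 1 - r)"
  proof -
    have "a / fact k \<le> a" if "0 \<le> a" for a :: real and k :: nat
      using that divide_left_mono[OF fact_ge_1, of a k] by simp
    then show ?thesis using assms by simp
  qed
  finally show ?thesis .
qed

text \<open>Both bounds on \<open>\<xi>\<close> are used later: the one by \<open>max\<close> keeps
  \<open>\<xi>\<close> where estimates in terms of \<open>M\<close> hold, and closeness to
  \<open>s\<close> yields the second factor \<open>\<bar>t - s\<bar>\<close> of a quadratic
  remainder.\<close>

lemma MVT_real:
  fixes f f' :: "real \<Rightarrow> real"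
  assumes "\<And>x. (f has_real_derivative f' x) (at x)"
  shows "\<exists>\<xi>. \<bar>\<xi> - s\<bar> \<le> \<bar>t - s\<bar> \<and> \<bar>\<xi>\<bar> \<le> max \<bar>s\<bar> \<bar>t\<bar> \<and> f t - f s = f' \<xi> * (t - s)"
proof -
  consider "s < t" | "t < s" | "s = t" by linarith
  then show ?thesis
  proof cases
    case 1
    from MVT2[OF this assms] obtain \<xi> where "\<xi> > s" "\<xi> < t" "f t - f s = (t - s) * f' \<xi>" by auto
    then show ?thesis by (intro exI[of _ \<xi>]) (auto simp: mult.commute)
  next
    case 2
    from MVT2[OF this assms] obtain \<xi> where "\<xi> > t" "\<xi> < s" "f s - f t = (s - t) * f' \<xi>" by auto
    then show ?thesis by (intro exI[of _ \<xi>]) (auto simp: algebra_simps)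
  next
    case 3
    then show ?thesis by (intro exI[of _ s]) auto
  qed
qed

text \<open>At \<open>r = p\<close> the function is \<open>s\<close> or \<open>\<bar>s\<bar>\<close>
  by parity, so differentiability at \<open>0\<close> may be lost; the constant is then
  \<open>M ^ 0 = 1\<close>, exactly what the class demands. Lower orders follow from the mean value
  theorem.\<close>

lemma pow_deriv_lipschitz:
  assumes "r \<le> p" "\<bar>s\<bar> \<le> M" "\<bar>t\<bar> \<le> M"
  shows "\<bar>pow_deriv p r t - pow_deriv p r s\<bar> \<le> M ^ (p - r) * \<bar>t - s\<bar>"
proof (cases "r = p")
  case True
  have "sgn x ^ p * \<bar>x\<bar> = (if even p then \<bar>x\<bar> else x)" for x :: real
    by (auto simp: sgn_real_def)
  then show ?thesis
    using True by (auto simp: pow_deriv_def)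
next
  case False
  then have "r < p" using assms by simp
  from MVT_real[of "pow_deriv p r", OF DERIV_pow_deriv[OF this], of s t]
  obtain \<xi> where \<xi>: "\<bar>\<xi>\<bar> \<le> M" "pow_deriv p r t - pow_deriv p r s = pow_deriv p (Suc r) \<xi> * (t - s)"
    using assms(2,3) by (meson max.bounded_iff order_trans)
  then show ?thesis
    using abs_pow_deriv_le[OF \<xi>(1), of p "Suc r"] by (auto simp: abs_mult intro!: mult_right_mono)
qed

text \<open>For \<open>r + 1 = p\<close> no second derivative need exist, so the quadratic bound
  comes from the mean value theorem combined with the Lipschitz bound for the next
  derivative.\<close>

lemma pow_deriv_remainder:
  assumes "r < p" "\<bar>s\<bar> \<le> M" "\<bar>t\<bar> \<le> M"
  shows "\<bar>pow_deriv p r t - pow_deriv p r s - pow_deriv p (Suc r) s * (t - s)\<bar>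
    \<le> M ^ (p - Suc r) * (t - s)\<^sup>2"
proof -
  from MVT_real[of "pow_deriv p r", OF DERIV_pow_deriv[OF assms(1)], of s t]
  obtain \<xi> where \<xi>: "\<bar>\<xi> - s\<bar> \<le> \<bar>t - s\<bar>" "\<bar>\<xi>\<bar> \<le> M"
      "pow_deriv p r t - pow_deriv p r s = pow_deriv p (Suc r) \<xi> * (t - s)"
    using assms(2,3) by (meson max.bounded_iff order_trans)
  have M: "M \<ge> 0" using assms by linarith
  have "\<bar>pow_deriv p (Suc r) \<xi> - pow_deriv p (Suc r) s\<bar> \<le> M ^ (p - Suc r) * \<bar>\<xi> - s\<bar>"
    using assms \<xi>(2) by (intro pow_deriv_lipschitz) auto
  also have "\<dots> \<le> M ^ (p - Suc r) * \<bar>t - s\<bar>"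
    using \<xi>(1) M by (intro mult_left_mono) auto
  finally have "\<bar>pow_deriv p (Suc r) \<xi> - pow_deriv p (Suc r) s\<bar> * \<bar>t - s\<bar>
      \<le> M ^ (p - Suc r) * \<bar>t - s\<bar> * \<bar>t - s\<bar>"
    by (rule mult_right_mono) simp
  moreover have "pow_deriv p r t - pow_deriv p r s - pow_deriv p (Suc r) s * (t - s)
      = (pow_deriv p (Suc r) \<xi> - pow_deriv p (Suc r) s) * (t - s)"
    unfolding \<xi>(3) by (simp add: left_diff_distrib)
  ultimately show ?thesis by (simp add: abs_mult power2_eq_square mult.assoc)
qed

lemma pow_deriv_1_mono:
  assumes "s \<le> t"
  shows "pow_deriv p 1 s \<le> pow_deriv p 1 t"
proof -
  have "sgn s * \<bar>s\<bar> ^ p \<le> sgn t * \<bar>t\<bar> ^ p"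
  proof -
    consider "0 \<le> s" | "t \<le> 0" | "s < 0" "0 < t" by linarith
    then show ?thesis
    proof cases
      case 1
      then show ?thesis using assms power_mono[of s t p] by (auto simp: sgn_real_def)
    next
      case 2
      then show ?thesis using assms power_mono[of "-t" "-s" p] by (auto simp: sgn_real_def)
    next
      case 3
      then have "sgn s * \<bar>s\<bar> ^ p \<le> 0" "0 \<le> sgn t * \<bar>t\<bar> ^ p" by auto
      then show ?thesis by linarith
    qed
  qed
  then show ?thesis by (simp add: pow_deriv_def divide_right_mono)
qed

lemma convex_pow_deriv_0:
  assumes "p \<ge> 1"
  shows "convex_on UNIV (pow_deriv p 0)"
  using pow_deriv_1_mono DERIV_pow_deriv[of 0 p] assms
  by (intro convex_on_realI[where f'="pow_deriv p 1"]) auto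

section \<open>Bregman divergences of the power function\<close>

text \<open>
  \<open>bregman p r s d\<close> is the \<open>r\<close>-th derivative in \<open>s\<close> of the Bregman divergence of
  \<open>\<bar>s\<bar>\<^sup>p\<^sup>+\<^sup>1 / (p + 1)!\<close> from \<open>d\<close> to \<open>s\<close>.
\<close>

definition bregman :: "nat \<Rightarrow> nat \<Rightarrow> real \<Rightarrow> real \<Rightarrow> real" where
  "bregman p r s d = pow_deriv p r s -
     (if r = 0 then pow_deriv p 0 d + pow_deriv p 1 d * (s - d)
      else if r = 1 then pow_deriv p 1 d else 0)"

lemma bregman_nonneg:
  assumes "p \<ge> 1"
  shows "0 \<le> bregman p 0 s d"
proof -
  have "pow_deriv p 1 d * (s - d) \<le> pow_deriv p 0 s - pow_deriv p 0 d"
    by (rule convex_on_imp_above_tangent[OF convex_pow_deriv_0[OF assms]])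
      (use DERIV_pow_deriv[of 0 p] assms in auto)
  then show ?thesis by (simp add: bregman_def)
qed

lemma bregman_self: "bregman p 0 d d = 0"
  by (simp add: bregman_def)

lemma convex_bregman:
  assumes "p \<ge> 1"
  shows "convex_on UNIV (\<lambda>s. bregman p 0 s d)"
proof -
  have "convex_on UNIV (\<lambda>s. pow_deriv p 0 s + (- (pow_deriv p 0 d + pow_deriv p 1 d * (s - d))))"
    by (rule convex_on_add[OF convex_pow_deriv_0[OF assms]])
      (auto intro!: convex_onI simp: algebra_simps)
  moreover have "(\<lambda>s. bregman p 0 s d)
      = (\<lambda>s. pow_deriv p 0 s + (- (pow_deriv p 0 d + pow_deriv p 1 d * (s - d))))"
    by (simp add: bregman_def fun_eq_iff)
  ultimately show ?thesis by simp
qed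

lemma bregman_lipschitz:
  assumes "1 \<le> r" "r \<le> p" "\<bar>s\<bar> \<le> M" "\<bar>t\<bar> \<le> M"
  shows "\<bar>bregman p r t d - bregman p r s d\<bar> \<le> M ^ (p - r) * \<bar>t - s\<bar>"
  using pow_deriv_lipschitz[OF assms(2-4)] assms(1) by (simp add: bregman_def)

text \<open>The subtracted part is affine in \<open>s\<close>, so its first-order remainder is
  zero.\<close>

lemma bregman_remainder:
  assumes "r < p" "\<bar>s\<bar> \<le> M" "\<bar>t\<bar> \<le> M"
  shows "\<bar>bregman p r t d - bregman p r s d - bregman p (Suc r) s d * (t - s)\<bar>
    \<le> M ^ (p - Suc r) * (t - s)\<^sup>2"
  using pow_deriv_remainder[OF assms] by (cases "r = 0") (auto simp: bregman_def algebra_simps)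

text \<open>At \<open>r = 1\<close> the value is a difference of derivatives at \<open>s\<close> and
  \<open>d\<close>; at \<open>r \<ge> 2\<close> nothing is subtracted and the derivative vanishes at
  \<open>0\<close>. The bound is linear in the coefficients so that Cauchy-Schwarz can pair it with
  one argument of the form.\<close>

lemma bregman_le:
  assumes "1 \<le> r" "r \<le> p" "\<bar>s\<bar> \<le> M" "\<bar>d\<bar> \<le> M"
  shows "\<bar>bregman p r s d\<bar> \<le> M ^ (p - r) * (\<bar>s - d\<bar> + \<bar>s\<bar>)"
proof (cases "r = 1")
  case True
  then have "\<bar>bregman p r s d\<bar> \<le> M ^ (p - r) * \<bar>s - d\<bar>"
    using pow_deriv_lipschitz[of 1 p d M s] assms by (simp add: bregman_def)
  also have "\<dots> \<le> M ^ (p - r) * (\<bar>s - d\<bar> + \<bar>s\<bar>)"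
    using assms by (intro mult_left_mono) auto
  finally show ?thesis .
next
  case False
  then have "\<bar>bregman p r s d\<bar> \<le> M ^ (p - r) * \<bar>s\<bar>"
    using pow_deriv_lipschitz[of r p 0 M s] assms by (simp add: bregman_def pow_deriv_0)
  also have "\<dots> \<le> M ^ (p - r) * (\<bar>s - d\<bar> + \<bar>s\<bar>)"
    using assms by (intro mult_left_mono) auto
  finally show ?thesis .
qed

lemma bregman_0_le:
  assumes "1 \<le> p" "\<bar>s\<bar> \<le> M" "\<bar>d\<bar> \<le> M"
  shows "\<bar>bregman p 0 s d\<bar> \<le> M ^ (p - 1) * (s - d)\<^sup>2"
  using pow_deriv_remainder[of 0 p d M s] assms by (simp add: bregman_def algebra_simps)

text \<open>The exact value is \<open>\<bar>d\<bar> ^ (p + 1)\<close> times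
  \<open>1 / fact p - 1 / fact (p + 1)\<close>, and \<open>p + 1 \<ge> 2\<close> makes the first
  fraction at least twice the second.\<close>

lemma bregman_0_at_0:
  assumes "p \<ge> 1"
  shows "\<bar>d\<bar> ^ (p + 1) / fact (p + 1) \<le> bregman p 0 0 d"
proof -
  have "bregman p 0 0 d = \<bar>d\<bar> ^ (p + 1) / fact p - \<bar>d\<bar> ^ (p + 1) / fact (p + 1)"
  proof -
    have "sgn d * d = \<bar>d\<bar>" by (simp add: sgn_real_def)
    then have "pow_deriv p 1 d * d = \<bar>d\<bar> ^ (p + 1) / fact p"
      by (simp add: pow_deriv_def mult.commute mult.left_commute)
    then show ?thesis
      using assms by (simp add: bregman_def pow_deriv_0) (simp add: pow_deriv_def)
  qed
  moreover have "2 / fact (p + 1) \<le> (1 :: real) / fact p"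
    using assms by (simp add: divide_simps)
  then have "2 * \<bar>d\<bar> ^ (p + 1) / fact (p + 1) \<le> \<bar>d\<bar> ^ (p + 1) / fact p"
    using mult_left_mono[of "2 / fact (p + 1)" "1 / fact p" "\<bar>d\<bar> ^ (p + 1)"]
    by (simp del: fact_Suc add: mult.commute)
  ultimately show ?thesis by (simp del: fact_Suc)
qed

section \<open>Tools for series, form norms and products of functionals\<close>

text \<open>One bound on finite absolute sums gives both convergence and the estimate, so the
  analysis below can stay with finite sums.\<close>

lemma summable_suminf_bound:
  fixes f :: "nat \<Rightarrow> real"
  assumes "\<And>n. (\<Sum>m<n. \<bar>f m\<bar>) \<le> C"
  shows "summable f" "\<bar>suminf f\<bar> \<le> C"
proof -
  have s: "summable (\<lambda>m. \<bar>f m\<bar>)"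
    by (rule bounded_imp_summable[where B=C]) (use assms[of "Suc _"] in \<open>auto simp: lessThan_Suc_atMost\<close>)
  then show "summable f" by (rule summable_rabs_cancel)
  have "\<bar>suminf f\<bar> \<le> (\<Sum>m. \<bar>f m\<bar>)" by (rule summable_rabs[OF s])
  also have "\<dots> \<le> C" by (rule suminf_le_const[OF s assms])
  finally show "\<bar>suminf f\<bar> \<le> C" .
qed

text \<open>\<open>form_norm\<close> is a real supremum, so even nonnegativity requires boundedness;
  the zero list shows that the index set is nonempty.\<close>

lemma form_norm_bounds:
  fixes T :: "'a::real_normed_vector list \<Rightarrow> real"
  assumes "\<And>vs. length vs = r \<Longrightarrow> \<forall>v\<in>set vs. norm v \<le> 1 \<Longrightarrow> \<bar>T vs\<bar> \<le> C"
  shows "0 \<le> form_norm r T" "form_norm r T \<le> C"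
proof -
  let ?V = "{vs::'a list. length vs = r \<and> (\<forall>v\<in>set vs. norm v \<le> 1)}"
  have mem: "replicate r 0 \<in> ?V" by auto
  then have ne: "?V \<noteq> {}" by blast
  have "bdd_above ((\<lambda>vs. \<bar>T vs\<bar>) ` ?V)" using assms by (auto intro!: bdd_aboveI2[where M=C])
  from cSUP_upper[OF mem this] show "0 \<le> form_norm r T"
    unfolding form_norm_def using abs_ge_zero order_trans by blast
  show "form_norm r T \<le> C"
    unfolding form_norm_def by (rule cSUP_least[OF ne]) (use assms in auto)
qed

lemma prod_list_map_update_linear:
  fixes c :: "'a::real_vector \<Rightarrow> real"
  assumes "linear c" "i < length vs"
  shows "linear (\<lambda>v. prod_list (map c (vs[i := v])))"
proof -
  have "(\<lambda>v. prod_list (map c (vs[i := v])))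
      = (\<lambda>v. (prod_list (map c (take i vs)) * prod_list (map c (drop (Suc i) vs))) *\<^sub>R c v)"
    using assms(2) by (simp add: upd_conv_take_nth_drop fun_eq_iff)
  then show ?thesis using linear_compose_scale_right[OF assms(1)] by simp
qed

lemma abs_prod_list_map_le:
  fixes c :: "'a \<Rightarrow> real"
  assumes "\<And>v. v \<in> set vs \<Longrightarrow> \<bar>c v\<bar> \<le> N v"
  shows "\<bar>prod_list (map c vs)\<bar> \<le> prod_list (map N vs)"
  using assms
proof (induction vs)
  case (Cons v vs)
  have "\<bar>c v\<bar> * \<bar>prod_list (map c vs)\<bar> \<le> N v * prod_list (map N vs)"
    using Cons by (intro mult_mono) (auto intro: order.trans[OF abs_ge_zero])
  then show ?case by (simp add: abs_mult)
qed simp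


text \<open>This serves two limits: with fixed arguments \<open>W\<close> is the product of their
  norms, and for the operator norm \<open>W\<close> is \<open>1\<close>.\<close>

lemma quadratic_remainder_tendsto:
  fixes x :: "'a::real_normed_vector" and g :: "'a \<Rightarrow> real"
  assumes "\<And>y. 0 \<le> g y" "\<And>y. g y \<le> (norm x + norm y) ^ k * (norm (y - x))\<^sup>2 * W"
  shows "((\<lambda>y. g y / norm (y - x)) \<longlongrightarrow> 0) (at x)"
proof (rule Lim_null_comparison)
  \<comment> \<open>At \<open>y = x\<close> both sides are \<open>0\<close>, the left one by the
    convention for division by zero.\<close>
  have "g y / norm (y - x) \<le> (norm x + norm y) ^ k * norm (y - x) * W" for y
    using assms(2)[of y] by (cases "y = x") (simp_all add: divide_simps power2_eq_square mult_ac)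
  then show "\<forall>\<^sub>F y in at x. norm (g y / norm (y - x)) \<le> (norm x + norm y) ^ k * norm (y - x) * W"
    using assms(1) by (intro always_eventually) simp
  have "((\<lambda>y. (norm x + norm y) ^ k * norm (y - x) * W)
      \<longlongrightarrow> (norm x + norm x) ^ k * norm (x - x) * W) (at x)"
    by (intro tendsto_intros)
  then show "((\<lambda>y. (norm x + norm y) ^ k * norm (y - x) * W) \<longlongrightarrow> 0) (at x)" by simp
qed

section \<open>Forms built from a system satisfying Bessel's inequality\<close>

text \<open>Orthogonality would be too much to ask: consecutive differences of basis vectors share a
  vector.\<close>

locale bessel_system =
  fixes u :: "nat \<Rightarrow> 'a::real_inner"
  assumes bessel: "(\<Sum>m<n. (x \<bullet> u m)\<^sup>2) \<le> (norm x)\<^sup>2"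
begin

lemma abs_coeff_le: "\<bar>x \<bullet> u m\<bar> \<le> norm x"
proof -
  have "(x \<bullet> u m)\<^sup>2 \<le> (\<Sum>m<Suc m. (x \<bullet> u m)\<^sup>2)" by (simp add: sum_nonneg)
  also note bessel
  finally show ?thesis by (simp add: abs_le_square_iff[symmetric])
qed

lemma abs_coeff_le_add: "\<bar>v \<bullet> u m\<bar> \<le> norm v + norm w" "\<bar>v \<bullet> u m\<bar> \<le> norm w + norm v"
  using abs_coeff_le[of v m] by (auto intro: add_increasing add_increasing2)

lemma sum_abs_coeff_le: "(\<Sum>m<n. \<bar>x \<bullet> u m\<bar> * \<bar>y \<bullet> u m\<bar>) \<le> norm x * norm y"
proof -
  have L2: "L2_set (\<lambda>m. v \<bullet> u m) {..<n} \<le> norm v" for v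
    unfolding L2_set_def using real_sqrt_le_mono[OF bessel[of v n]] by simp
  have "(\<Sum>m<n. \<bar>x \<bullet> u m\<bar> * \<bar>y \<bullet> u m\<bar>)
      \<le> L2_set (\<lambda>m. x \<bullet> u m) {..<n} * L2_set (\<lambda>m. y \<bullet> u m) {..<n}"
    by (rule L2_set_mult_ineq)
  also have "\<dots> \<le> norm x * norm y" by (intro mult_mono L2) auto
  finally show ?thesis .
qed

lemma linear_prod_coeff:
  assumes "i < length vs"
  shows "linear (\<lambda>v. prod_list (map (\<lambda>v. v \<bullet> u m) (vs[i := v])))"
  by (rule prod_list_map_update_linear[OF _ assms])
    (simp add: bounded_linear.linear[OF bounded_linear_inner_left])

lemma abs_prod_coeff_le: "\<bar>prod_list (map (\<lambda>v. v \<bullet> u m) vs)\<bar> \<le> prod_list (map norm vs)"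
  by (rule abs_prod_list_map_le) (rule abs_coeff_le)

lemma prod_norm_nonneg: "0 \<le> prod_list (map norm (vs :: 'a list))"
  by (induction vs) auto

lemma prod_norm_le_1: "\<forall>v\<in>set vs. norm v \<le> 1 \<Longrightarrow> prod_list (map norm (vs :: 'a list)) \<le> 1"
  by (induction vs) (auto intro: mult_le_one prod_norm_nonneg)

text \<open>Cauchy-Schwarz pairs the linear bound on \<open>a m\<close> with the first argument, and
  the other factors are bounded by norms. This is why the list must be nonempty.\<close>

lemma sum_form_le:
  assumes "0 \<le> K" "\<And>m. \<bar>a m\<bar> \<le> K * (\<bar>x \<bullet> u m\<bar> + \<bar>y \<bullet> u m\<bar>)" "vs \<noteq> []"
  shows "(\<Sum>m<n. \<bar>a m * prod_list (map (\<lambda>v. v \<bullet> u m) vs)\<bar>)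
    \<le> K * (norm x + norm y) * prod_list (map norm vs)"
proof -
  obtain v ws where vs: "vs = v # ws" using assms(3) by (cases vs) auto
  define W where "W = prod_list (map norm ws)"
  have W: "0 \<le> W" unfolding W_def by (rule prod_norm_nonneg)
  have "\<bar>a m * prod_list (map (\<lambda>v. v \<bullet> u m) vs)\<bar>
      \<le> K * (\<bar>x \<bullet> u m\<bar> + \<bar>y \<bullet> u m\<bar>) * (\<bar>v \<bullet> u m\<bar> * W)" for m
    unfolding vs list.map prod_list.Cons abs_mult
    using assms(1,2) abs_prod_coeff_le[of m ws] by (intro mult_mono) (auto simp: W_def)
  then have "(\<Sum>m<n. \<bar>a m * prod_list (map (\<lambda>v. v \<bullet> u m) vs)\<bar>)
      \<le> (\<Sum>m<n. K * (\<bar>x \<bullet> u m\<bar> + \<bar>y \<bullet> u m\<bar>) * (\<bar>v \<bullet> u m\<bar> * W))"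
    by (rule sum_mono)
  also have "\<dots> = K * W * ((\<Sum>m<n. \<bar>x \<bullet> u m\<bar> * \<bar>v \<bullet> u m\<bar>) + (\<Sum>m<n. \<bar>y \<bullet> u m\<bar> * \<bar>v \<bullet> u m\<bar>))"
    by (simp add: sum_distrib_left sum.distrib[symmetric] algebra_simps)
  also have "\<dots> \<le> K * W * (norm x * norm v + norm y * norm v)"
    using assms(1) W by (intro mult_left_mono add_mono sum_abs_coeff_le) auto
  finally show ?thesis by (simp add: vs W_def algebra_simps)
qed

text \<open>The coefficients are summable by Bessel alone, so all arguments are bounded by norms and
  the empty list, hence order \<open>0\<close>, is covered.\<close>

lemma sum_form_le_square:
  assumes "0 \<le> K" "\<And>m. \<bar>a m\<bar> \<le> K * (x \<bullet> u m)\<^sup>2"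
  shows "(\<Sum>m<n. \<bar>a m * prod_list (map (\<lambda>v. v \<bullet> u m) vs)\<bar>)
    \<le> K * (norm x)\<^sup>2 * prod_list (map norm vs)"
proof -
  have "(\<Sum>m<n. \<bar>a m * prod_list (map (\<lambda>v. v \<bullet> u m) vs)\<bar>)
      \<le> (\<Sum>m<n. K * (x \<bullet> u m)\<^sup>2 * prod_list (map norm vs))"
    unfolding abs_mult
    using assms abs_prod_coeff_le[of _ vs] by (intro sum_mono mult_mono) auto
  also have "\<dots> = K * (\<Sum>m<n. (x \<bullet> u m)\<^sup>2) * prod_list (map norm vs)"
    by (simp add: sum_distrib_left sum_distrib_right)
  also have "\<dots> \<le> K * (norm x)\<^sup>2 * prod_list (map norm vs)"
    using assms(1) by (intro mult_left_mono mult_right_mono bessel prod_norm_nonneg)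
  finally show ?thesis .
qed

end

section \<open>The objective, its derivatives and its membership in the class\<close>

locale bregman_sum = bessel_system u for u :: "nat \<Rightarrow> 'a::real_inner" +
  fixes p :: nat and z :: 'a
  assumes p_pos: "1 \<le> p"
begin

text \<open>The candidate for the \<open>r\<close>-th derivative, obtained termwise;
  \<open>nabla_obj\<close> confirms it for \<open>r \<le> p\<close>.\<close>

definition form :: "nat \<Rightarrow> 'a \<Rightarrow> 'a list \<Rightarrow> real" where
  "form r x vs = (\<Sum>m. bregman p r (x \<bullet> u m) (z \<bullet> u m) * prod_list (map (\<lambda>v. v \<bullet> u m) vs))"

definition obj :: "'a \<Rightarrow> real" where
  "obj x = (\<Sum>m. bregman p 0 (x \<bullet> u m) (z \<bullet> u m))"

lemma form_terms_bound:
  assumes "1 \<le> r" "r \<le> p" "length vs = r"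
  shows "(\<Sum>m<n. \<bar>bregman p r (x \<bullet> u m) (z \<bullet> u m) * prod_list (map (\<lambda>v. v \<bullet> u m) vs)\<bar>)
    \<le> (norm x + norm z) ^ (p - r) * (norm (x - z) + norm x) * prod_list (map norm vs)"
proof (rule sum_form_le)
  show "\<bar>bregman p r (x \<bullet> u m) (z \<bullet> u m)\<bar>
      \<le> (norm x + norm z) ^ (p - r) * (\<bar>(x - z) \<bullet> u m\<bar> + \<bar>x \<bullet> u m\<bar>)" for m
    unfolding inner_diff_left using assms by (intro abs_coeff_le_add bregman_le)
qed (use assms in auto)

lemma summable_form:
  assumes "r \<le> p" "length vs = r"
  shows "summable (\<lambda>m. bregman p r (x \<bullet> u m) (z \<bullet> u m) * prod_list (map (\<lambda>v. v \<bullet> u m) vs))"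
proof (cases "r = 0")
  case True
  have "\<bar>bregman p 0 (x \<bullet> u m) (z \<bullet> u m)\<bar> \<le> (norm x + norm z) ^ (p - 1) * ((x - z) \<bullet> u m)\<^sup>2" for m
    unfolding inner_diff_left using p_pos by (intro abs_coeff_le_add bregman_0_le)
  from summable_suminf_bound(1)[OF sum_form_le_square[OF _ this]] show ?thesis
    unfolding True by simp
next
  case False
  then show ?thesis
    using assms by (intro summable_suminf_bound(1)[OF form_terms_bound]) auto
qed

lemma obj_eq_form: "obj x = form 0 x []"
  by (simp add: obj_def form_def)

lemma summable_obj: "summable (\<lambda>m. bregman p 0 (x \<bullet> u m) (z \<bullet> u m))"
  using summable_form[of 0 "[]"] by simp

lemma abs_form_le:
  assumes "1 \<le> r" "r \<le> p" "length vs = r"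
  shows "\<bar>form r x vs\<bar>
    \<le> (norm x + norm z) ^ (p - r) * (norm (x - z) + norm x) * prod_list (map norm vs)"
  unfolding form_def by (rule summable_suminf_bound(2)[OF form_terms_bound[OF assms]])

lemma linear_form:
  assumes "r \<le> p" "length vs = r" "i < r"
  shows "linear (\<lambda>v. form r x (vs[i := v]))"
proof (rule linearI)
  note S = summable_form[OF assms(1)]
  have lin: "linear (\<lambda>v. prod_list (map (\<lambda>v. v \<bullet> u m) (vs[i := v])))" for m
    using assms by (intro linear_prod_coeff) simp
  show "form r x (vs[i := v + w]) = form r x (vs[i := v]) + form r x (vs[i := w])" for v w
    unfolding form_def using assms(2)
    by (subst suminf_add[OF S S]) (simp_all add: linear_add[OF lin] distrib_left)
  show "form r x (vs[i := c *\<^sub>R v]) = c *\<^sub>R form r x (vs[i := v])" for c v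
    unfolding form_def real_scaleR_def using assms(2)
    by (subst suminf_mult[OF S, symmetric]) (simp_all add: linear_scale[OF lin] mult_ac)
qed

lemma bounded_multilinear_form:
  assumes "1 \<le> r" "r \<le> p"
  shows "bounded_multilinear r (form r x)"
  unfolding bounded_multilinear_def using linear_form[OF assms(2)] abs_form_le[OF assms] by blast

text \<open>Termwise remainders are quadratic in the coefficients of \<open>y - x\<close>, so they
  sum without help from \<open>vs\<close>. The bound is therefore uniform over unit arguments, as
  differentiability in the operator norm requires.\<close>

lemma form_remainder:
  assumes "r < p" "length vs = r"
  shows "\<bar>form r y vs - form r x vs - form (Suc r) x ((y - x) # vs)\<bar>
    \<le> (norm x + norm y) ^ (p - Suc r) * (norm (y - x))\<^sup>2 * prod_list (map norm vs)"
proof -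
  let ?b = "\<lambda>r x m. bregman p r (x \<bullet> u m) (z \<bullet> u m)"
  let ?\<pi> = "\<lambda>vs m. prod_list (map (\<lambda>v. v \<bullet> u m) vs)"
  have S: "summable (\<lambda>m. ?b r x m * ?\<pi> vs m)" for x
    using assms by (intro summable_form) auto
  have S': "summable (\<lambda>m. ?b (Suc r) x m * ?\<pi> ((y - x) # vs) m)"
    using assms by (intro summable_form) auto
  have "form r y vs - form r x vs - form (Suc r) x ((y - x) # vs)
      = (\<Sum>m. ?b r y m * ?\<pi> vs m - ?b r x m * ?\<pi> vs m - ?b (Suc r) x m * ?\<pi> ((y - x) # vs) m)"
    unfolding form_def using S S' by (simp add: suminf_diff summable_diff)
  also have "\<dots> = (\<Sum>m. (?b r y m - ?b r x m - ?b (Suc r) x m * (y \<bullet> u m - x \<bullet> u m)) * ?\<pi> vs m)"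
    by (simp add: algebra_simps)
  also have "\<bar>\<dots>\<bar> \<le> (norm x + norm y) ^ (p - Suc r) * (norm (y - x))\<^sup>2 * prod_list (map norm vs)"
  proof (intro summable_suminf_bound(2) sum_form_le_square)
    show "\<bar>?b r y m - ?b r x m - ?b (Suc r) x m * (y \<bullet> u m - x \<bullet> u m)\<bar>
        \<le> (norm x + norm y) ^ (p - Suc r) * ((y - x) \<bullet> u m)\<^sup>2" for m
      unfolding inner_diff_left using assms by (intro abs_coeff_le_add bregman_remainder)
  qed auto
  finally show ?thesis .
qed

lemma form_lipschitz:
  assumes "length vs = p"
  shows "\<bar>form p y vs - form p x vs\<bar> \<le> norm (y - x) * prod_list (map norm vs)"
proof -
  let ?b = "\<lambda>x m. bregman p p (x \<bullet> u m) (z \<bullet> u m)"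
  let ?\<pi> = "\<lambda>m. prod_list (map (\<lambda>v. v \<bullet> u m) vs)"
  have "form p y vs - form p x vs = (\<Sum>m. (?b y m - ?b x m) * ?\<pi> m)"
    unfolding form_def using assms
    by (subst suminf_diff[OF summable_form summable_form]) (auto simp: algebra_simps)
  \<comment> \<open>One vector is enough here, so \<open>0\<close> fills the second slot of
    \<open>sum_form_le\<close>.\<close>
  also have "\<bar>\<dots>\<bar> \<le> 1 * (norm (y - x) + norm (0::'a)) * prod_list (map norm vs)"
  proof (intro summable_suminf_bound(2) sum_form_le)
    show "\<bar>?b y m - ?b x m\<bar> \<le> 1 * (\<bar>(y - x) \<bullet> u m\<bar> + \<bar>0 \<bullet> u m\<bar>)" for m
      using bregman_lipschitz[OF p_pos order.refl, of "x \<bullet> u m" "max \<bar>x \<bullet> u m\<bar> \<bar>y \<bullet> u m\<bar>" "y \<bullet> u m"]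
      by (simp add: inner_diff_left)
  qed (use assms p_pos in auto)
  finally show ?thesis by simp
qed

lemma has_derivative_form:
  assumes "r < p" "length vs = r"
  shows "((\<lambda>y. form r y vs) has_derivative (\<lambda>h. form (Suc r) x (h # vs))) (at x)"
  unfolding has_derivative_iff_norm
proof
  have lin: "linear (\<lambda>h. form (Suc r) x (h # vs))"
    using linear_form[of "Suc r" "0 # vs" 0 x] assms by simp
  let ?K = "(norm x + norm z) ^ (p - Suc r) * (norm (x - z) + norm x) * prod_list (map norm vs)"
  have "norm (form (Suc r) x (h # vs)) \<le> norm h * ?K" for h
    using abs_form_le[of "Suc r" "h # vs" x] assms by (simp add: mult_ac)
  then show "bounded_linear (\<lambda>h. form (Suc r) x (h # vs))"
    by (intro bounded_linear_intro[where K = ?K] linear_add[OF lin] linear_scale[OF lin])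
  show "((\<lambda>y. norm (form r y vs - form r x vs - form (Suc r) x ((y - x) # vs)) / norm (y - x))
      \<longlongrightarrow> 0) (at x)"
    using form_remainder[OF assms] by (intro quadratic_remainder_tendsto) auto
qed

text \<open>\<open>nabla\<close> differentiates with the remaining arguments fixed, so
  \<open>has_derivative_form\<close> and uniqueness of the Frechet derivative carry the
  induction.\<close>

lemma nabla_obj: "r \<le> p \<Longrightarrow> length vs = r \<Longrightarrow> nabla r obj x vs = form r x vs"
proof (induction r arbitrary: x vs)
  case 0
  then show ?case by (simp add: obj_eq_form)
next
  case (Suc r)
  then obtain v ws where vs: "vs = v # ws" "length ws = r" by (cases vs) auto
  have "(\<lambda>y. nabla r obj y ws) = (\<lambda>y. form r y ws)"
    using Suc vs by auto
  then have "((\<lambda>y. nabla r obj y ws) has_derivative (\<lambda>h. form (Suc r) x (h # ws))) (at x)"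
    using has_derivative_form[of r ws x] Suc.prems vs by simp
  from frechet_derivative_at[OF this] show ?case
    unfolding vs by (simp add: fun_eq_iff)
qed

lemma differentiable_through_obj: "differentiable_through p obj"
  unfolding differentiable_through_def
proof (intro allI impI conjI)
  fix r x assume r: "r < p"
  have "bounded_multilinear (Suc r) (form (Suc r) x)"
    using r by (intro bounded_multilinear_form) auto
  then show "bounded_multilinear (Suc r) (nabla (Suc r) obj x)"
    unfolding bounded_multilinear_def using r by (simp add: nabla_obj del: nabla.simps)
  let ?g = "\<lambda>y vs. nabla r obj y vs - nabla r obj x vs - nabla (Suc r) obj x ((y - x) # vs)"
  have *: "\<bar>?g y vs\<bar> \<le> (norm x + norm y) ^ (p - Suc r) * (norm (y - x))\<^sup>2 * 1"
    if "length vs = r" "\<forall>v\<in>set vs. norm v \<le> 1" for vs y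
  proof -
    have "\<bar>?g y vs\<bar> \<le> (norm x + norm y) ^ (p - Suc r) * (norm (y - x))\<^sup>2 * prod_list (map norm vs)"
      using form_remainder[OF r that(1)] r that(1) by (simp add: nabla_obj del: nabla.simps)
    also have "\<dots> \<le> (norm x + norm y) ^ (p - Suc r) * (norm (y - x))\<^sup>2 * 1"
      by (intro mult_left_mono prod_norm_le_1[OF that(2)]) auto
    finally show ?thesis .
  qed
  show "((\<lambda>y. form_norm r (?g y) / norm (y - x)) \<longlongrightarrow> 0) (at x)"
    by (rule quadratic_remainder_tendsto) (rule form_norm_bounds[OF *]; assumption)+
qed

lemma abs_nabla_obj_diff_le:
  assumes "length vs = p" "\<forall>v\<in>set vs. norm v \<le> 1"
  shows "\<bar>nabla p obj y vs - nabla p obj x vs\<bar> \<le> norm (y - x)"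
proof -
  have "\<bar>nabla p obj y vs - nabla p obj x vs\<bar> \<le> norm (y - x) * prod_list (map norm vs)"
    using form_lipschitz assms by (simp add: nabla_obj)
  also have "\<dots> \<le> norm (y - x) * 1" by (intro mult_left_mono prod_norm_le_1[OF assms(2)]) auto
  finally show ?thesis by simp
qed

lemma continuously_differentiable_through_obj: "continuously_differentiable_through p obj"
  unfolding continuously_differentiable_through_def
proof (intro conjI allI differentiable_through_obj)
  fix x :: 'a
  have "((\<lambda>y. norm (y - x)) \<longlongrightarrow> norm (x - x)) (at x)" by (intro tendsto_intros)
  then have lim: "((\<lambda>y. norm (y - x)) \<longlongrightarrow> 0) (at x)" by simp
  let ?T = "\<lambda>y vs. nabla p obj y vs - nabla p obj x vs"
  have "0 \<le> form_norm p (?T y)" "form_norm p (?T y) \<le> norm (y - x)" for y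
    by (rule form_norm_bounds[OF abs_nabla_obj_diff_le]; assumption)+
  then show "((\<lambda>y. form_norm p (?T y)) \<longlongrightarrow> 0) (at x)"
    by (intro Lim_null_comparison[OF always_eventually lim]) auto
qed

lemma obj_nonneg: "0 \<le> obj x"
  unfolding obj_def by (intro suminf_nonneg summable_obj bregman_nonneg[OF p_pos])

lemma obj_z: "obj z = 0"
  by (simp add: obj_def bregman_self)

lemma opt_val_obj: "opt_val obj = 0"
  unfolding opt_val_def
proof (rule antisym)
  show "(INF x. obj x) \<le> 0"
    using obj_nonneg by (intro cINF_lower2[of _ _ z]) (auto simp: obj_z intro!: bdd_belowI2)
  show "0 \<le> (INF x. obj x)" by (rule cINF_greatest) (auto simp: obj_nonneg)
qed

lemma convex_obj: "convex_on UNIV obj"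
proof (rule convex_onI)
  fix t x y assume t: "0 < t" "t < (1::real)"
  let ?b = "\<lambda>x m. bregman p 0 (x \<bullet> u m) (z \<bullet> u m)"
  note S = summable_mult[OF summable_obj]
  have "?b ((1 - t) *\<^sub>R x + t *\<^sub>R y) m \<le> (1 - t) * ?b x m + t * ?b y m" for m
    using convex_onD[OF convex_bregman[OF p_pos], of t "x \<bullet> u m" "y \<bullet> u m"] t
    by (simp add: inner_add_left)
  then have "obj ((1 - t) *\<^sub>R x + t *\<^sub>R y) \<le> (\<Sum>m. (1 - t) * ?b x m + t * ?b y m)"
    unfolding obj_def by (intro suminf_le summable_obj summable_add S)
  also have "\<dots> = (1 - t) * obj x + t * obj y"
    unfolding obj_def by (simp add: suminf_add[OF S S, symmetric] suminf_mult[OF summable_obj])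
  finally show "obj ((1 - t) *\<^sub>R x + t *\<^sub>R y) \<le> (1 - t) * obj x + t * obj y" .
qed simp

text \<open>All coefficients of \<open>z\<close> are at most \<open>1\<close> in absolute value, so
  at the origin the estimates hold with \<open>M = 1\<close> and reduce to
  \<open>norm z \<le> 1\<close>. The minimiser \<open>z\<close> itself witnesses the distance
  condition.\<close>

lemma obj_in_class:
  assumes "norm z \<le> 1"
  shows "obj \<in> smooth_convex_class p"
proof -
  have z: "\<bar>z \<bullet> u m\<bar> \<le> 1" for m using abs_coeff_le[of z m] assms by linarith
  have f0: "obj 0 \<le> 1"
  proof -
    have "\<bar>bregman p 0 0 (z \<bullet> u m)\<bar> \<le> 1 * (z \<bullet> u m)\<^sup>2" for m
      using bregman_0_le[OF p_pos, of 0 1 "z \<bullet> u m"] z[of m] by simp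
    then have "\<bar>obj 0\<bar> \<le> 1 * (norm z)\<^sup>2 * prod_list (map norm ([] :: 'a list))"
      unfolding obj_eq_form form_def inner_zero_left
      by (intro summable_suminf_bound(2) sum_form_le_square) auto
    also have "\<dots> \<le> 1" using assms by (simp add: power_le_one)
    finally show ?thesis by simp
  qed
  have grad: "form_norm r (nabla r obj 0) \<le> 1" if "r \<in> {1..p}" for r
  proof (rule form_norm_bounds(2))
    fix vs :: "'a list" assume vs: "length vs = r" "\<forall>v\<in>set vs. norm v \<le> 1"
    have "\<bar>bregman p r 0 (z \<bullet> u m)\<bar> \<le> 1 * (\<bar>z \<bullet> u m\<bar> + \<bar>0 \<bullet> u m\<bar>)" for m
      using bregman_le[of r p 0 1 "z \<bullet> u m"] that z[of m] by simp
    then have "\<bar>form r 0 vs\<bar> \<le> 1 * (norm z + norm (0::'a)) * prod_list (map norm vs)"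
      unfolding form_def inner_zero_left
      using vs that by (intro summable_suminf_bound(2) sum_form_le) auto
    also have "\<dots> \<le> 1" using assms prod_norm_le_1[OF vs(2)] prod_norm_nonneg by (simp add: mult_le_one)
    finally show "\<bar>nabla r obj 0 vs\<bar> \<le> 1" using that vs by (simp add: nabla_obj)
  qed
  have "z \<in> argmin_set obj"
    by (simp add: argmin_set_def is_arg_min_def obj_z not_less obj_nonneg)
  then have "ext_dist 0 (argmin_set obj) \<le> ereal (dist 0 z)"
    unfolding ext_dist_def by (rule INF_lower)
  also have "\<dots> \<le> 1" using assms by simp
  finally have dist: "ext_dist 0 (argmin_set obj) \<le> 1" .
  have lip: "form_norm p (\<lambda>vs. nabla p obj x vs - nabla p obj y vs) \<le> norm (x - y)" for x y
    by (rule form_norm_bounds(2)[OF abs_nabla_obj_diff_le])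
  have "bdd_below (range obj)" using obj_nonneg by (auto intro!: bdd_belowI2)
  then show ?thesis
    unfolding smooth_convex_class_def
    using convex_obj continuously_differentiable_through_obj lip f0 grad dist obj_nonneg
    by (simp add: opt_val_obj)
qed

end


section \<open>Orthonormal sequences and differences along rows\<close>

lemma inner_sum_orthonormal:
  fixes f :: "nat \<Rightarrow> 'a::real_inner"
  assumes "\<And>i j. f i \<bullet> f j = (if i = j then 1 else 0)"
  shows "(\<Sum>i<n. c i *\<^sub>R f i) \<bullet> f j = (if j < n then c j else 0)"
  by (simp add: inner_sum_left assms if_distrib[of "\<lambda>t. _ * t"] sum.delta cong: if_cong)

lemma norm_sum_orthonormal:
  fixes f :: "nat \<Rightarrow> 'a::real_inner"
  assumes "\<And>i j. f i \<bullet> f j = (if i = j then 1 else 0)"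
  shows "(norm (\<Sum>i<n. c i *\<^sub>R f i))\<^sup>2 = (\<Sum>i<n. (c i)\<^sup>2)"
proof -
  have "(norm (\<Sum>i<n. c i *\<^sub>R f i))\<^sup>2 = (\<Sum>j<n. c j * ((\<Sum>i<n. c i *\<^sub>R f i) \<bullet> f j))"
    by (simp add: power2_norm_eq_inner inner_sum_right)
  also have "\<dots> = (\<Sum>j<n. (c j)\<^sup>2)"
    by (intro sum.cong refl) (simp add: inner_sum_orthonormal[OF assms] power2_eq_square)
  finally show ?thesis .
qed

lemma bessel_inequality:
  fixes f :: "nat \<Rightarrow> 'a::real_inner"
  assumes "\<And>i j. f i \<bullet> f j = (if i = j then 1 else 0)"
  shows "(\<Sum>m<n. (x \<bullet> f m)\<^sup>2) \<le> (norm x)\<^sup>2"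
proof -
  define P where "P = (\<Sum>m<n. (x \<bullet> f m) *\<^sub>R f m)"
  have xP: "x \<bullet> P = (\<Sum>m<n. (x \<bullet> f m)\<^sup>2)"
    by (simp add: P_def inner_sum_right power2_eq_square)
  have PP: "P \<bullet> P = (\<Sum>m<n. (x \<bullet> f m)\<^sup>2)"
    using norm_sum_orthonormal[OF assms, of "\<lambda>m. x \<bullet> f m" n]
    by (simp add: P_def power2_norm_eq_inner)
  have "0 \<le> (x - P) \<bullet> (x - P)" by simp
  also have "\<dots> = (norm x)\<^sup>2 - (\<Sum>m<n. (x \<bullet> f m)\<^sup>2)"
    by (simp add: inner_diff_left inner_diff_right inner_commute[of P x] xP PP power2_norm_eq_inner)
  finally show ?thesis by simp
qed

text \<open>The basis is split into infinitely many rows, basis vector \<open>i\<close> of row \<open>b\<close> being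
  \<open>e (prod_encode (b, i))\<close>.\<close>

definition next_in_row :: "nat \<Rightarrow> nat" where
  "next_in_row m = (case prod_decode m of (b, i) \<Rightarrow> prod_encode (b, Suc i))"

text \<open>The factor \<open>1 / 2\<close> brings the Bessel constant down to \<open>1\<close>,
  since a basis vector can occur in two differences.\<close>

definition row_diff :: "(nat \<Rightarrow> 'a::real_inner) \<Rightarrow> nat \<Rightarrow> 'a" where
  "row_diff e m = (1 / 2) *\<^sub>R (e m - e (next_in_row m))"

lemma next_in_row_encode [simp]: "next_in_row (prod_encode (b, i)) = prod_encode (b, Suc i)"
  by (simp add: next_in_row_def)

lemma next_in_row_eq_iff: "next_in_row m = prod_encode (b, Suc i) \<longleftrightarrow> m = prod_encode (b, i)"
proof -
  obtain b' i' where "m = prod_encode (b', i')" by (metis prod_decode_inverse surj_pair)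
  then show ?thesis by (simp add: prod_encode_eq)
qed

lemma inj_next_in_row: "next_in_row m = next_in_row m' \<longleftrightarrow> m = m'"
proof -
  obtain b i where "m' = prod_encode (b, i)" by (metis prod_decode_inverse surj_pair)
  then show ?thesis by (simp add: next_in_row_eq_iff)
qed

text \<open>A squared halved difference is at most the mean of the two squares; the vectors
  \<open>e m\<close> and, by injectivity, their successors \<open>e (next_in_row m)\<close> each
  form an orthonormal sequence.\<close>

lemma bessel_system_row_diff:
  assumes orth: "\<And>i j. e i \<bullet> e j = (if i = j then 1 else 0)"
  shows "bessel_system (row_diff e)"
proof
  fix x n
  have "(x \<bullet> row_diff e m)\<^sup>2 \<le> ((x \<bullet> e m)\<^sup>2 + (x \<bullet> e (next_in_row m))\<^sup>2) / 2" for m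
  proof -
    have "0 \<le> (x \<bullet> e m + x \<bullet> e (next_in_row m))\<^sup>2" by simp
    then show ?thesis
      by (simp add: row_diff_def inner_diff_right power2_eq_square field_simps)
  qed
  then have "(\<Sum>m<n. (x \<bullet> row_diff e m)\<^sup>2)
      \<le> (\<Sum>m<n. ((x \<bullet> e m)\<^sup>2 + (x \<bullet> e (next_in_row m))\<^sup>2) / 2)"
    by (rule sum_mono)
  also have "\<dots> = ((\<Sum>m<n. (x \<bullet> e m)\<^sup>2) + (\<Sum>m<n. (x \<bullet> e (next_in_row m))\<^sup>2)) / 2"
    by (simp add: sum.distrib sum_divide_distrib[symmetric])
  also have "\<dots> \<le> (norm x)\<^sup>2"
    using bessel_inequality[of e x n] bessel_inequality[of "\<lambda>m. e (next_in_row m)" x n]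
    by (simp add: orth inj_next_in_row)
  finally show "(\<Sum>m<n. (x \<bullet> row_diff e m)\<^sup>2) \<le> (norm x)\<^sup>2" .
qed

section \<open>Spread of information along a row\<close>

locale row_chain = bregman_sum "row_diff e" p z for e :: "nat \<Rightarrow> 'a::real_inner" and p z +
  assumes orth: "e i \<bullet> e j = (if i = j then 1 else 0)"
begin

text \<open>
  Where \<open>x\<close> vanishes, the forms of order at least \<open>2\<close> vanish and the contributions of the two
  differences involving a coordinate cancel in the gradient.
\<close>

lemma not_in_form_supp:
  assumes r: "r \<in> {1..p}"
    and x: "\<And>l. l \<in> {i, Suc i, Suc (Suc i)} \<Longrightarrow> x \<bullet> e (prod_encode (b, l)) = 0"
    and z: "z \<bullet> row_diff e (prod_encode (b, i)) = z \<bullet> row_diff e (prod_encode (b, Suc i))"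
  shows "prod_encode (b, Suc i) \<notin> form_supp e r (nabla r obj x)"
proof
  let ?j = "prod_encode (b, Suc i)" and ?m = "prod_encode (b, i)"
  assume "?j \<in> form_supp e r (nabla r obj x)"
  then obtain js where js: "length js = r - 1" "nabla r obj x (e ?j # map e js) \<noteq> 0"
    by (auto simp: form_supp_def)
  let ?t = "\<lambda>m. bregman p r (x \<bullet> row_diff e m) (z \<bullet> row_diff e m)
    * prod_list (map (\<lambda>v. v \<bullet> row_diff e m) (e ?j # map e js))"
  \<comment> \<open>Having index \<open>Suc i\<close>, the coordinate lies in two differences, with
    opposite signs. The first coordinate of a row lies in only one, so nothing could cancel
    there.\<close>
  have e: "e ?j \<bullet> row_diff e m = (if m = ?j then 1 / 2 else if m = ?m then - 1 / 2 else 0)" for m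
    using next_in_row_eq_iff[of m b i]
    by (auto simp: row_diff_def inner_diff_right orth prod_encode_eq)
  have x0: "x \<bullet> row_diff e ?m = 0" "x \<bullet> row_diff e ?j = 0"
    using x by (simp_all add: row_diff_def inner_diff_right)
  have "form r x (e ?j # map e js) = sum ?t {?m, ?j}"
    unfolding form_def by (rule suminf_finite) (auto simp: e)
  also have "\<dots> = 0"
  proof (cases "r = 1")
    case True
    then show ?thesis using js x0 z by (simp add: e prod_encode_eq)
  next
    case False
    then have "bregman p r 0 d = 0" for d using r by (simp add: bregman_def pow_deriv_0)
    then show ?thesis using x0 by (simp add: prod_encode_eq)
  qed
  finally show False using js r by (simp add: nabla_obj)
qed

text \<open>The untouched window from \<open>t\<close> to \<open>k - t\<close> loses one coordinate
  at each end per call: a coordinate inside it at time \<open>t\<close> has both neighbours inside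
  it at every earlier time. The constant slope of \<open>z\<close> gives the equality needed for
  cancellation.\<close>

lemma zero_respecting_vanishes:
  assumes X: "zero_respecting e p obj X"
    and z: "\<And>i. i \<le> k \<Longrightarrow> z \<bullet> e (prod_encode (b, i)) = a * (real k - real i)"
  shows "t \<le> i \<Longrightarrow> i + t \<le> k \<Longrightarrow> X t \<bullet> e (prod_encode (b, i)) = 0"
proof (induction t arbitrary: i rule: less_induct)
  case (less t)
  have "prod_encode (b, i) \<notin> form_supp e r (nabla r obj (X s))" if st: "s < t" "r \<in> {1..p}" for r s
  proof -
    \<comment> \<open>Here \<open>0 \<le> s < t \<le> i\<close>, so a left neighbour exists; for
      \<open>t = 0\<close> there is no earlier query.\<close>
    obtain i' where i: "i = Suc i'" using st less.prems by (cases i) auto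
    show ?thesis
      unfolding i
    proof (rule not_in_form_supp[OF st(2)])
      show "X s \<bullet> e (prod_encode (b, l)) = 0" if "l \<in> {i', Suc i', Suc (Suc i')}" for l
        using less.IH[OF st(1), of l] less.prems st that i by auto
      show "z \<bullet> row_diff e (prod_encode (b, i')) = z \<bullet> row_diff e (prod_encode (b, Suc i'))"
        using z[of i'] z[of "Suc i'"] z[of "Suc (Suc i')"] less.prems st i
        by (simp add: row_diff_def inner_diff_right algebra_simps)
    qed
  qed
  moreover have "supp e (X t) \<subseteq> (\<Union>r\<in>{1..p}. \<Union>s\<in>{..<t}. form_supp e r (nabla r obj (X s)))"
    using X by (simp add: zero_respecting_def)
  ultimately have "prod_encode (b, i) \<notin> supp e (X t)" by blast
  then show ?case by (simp add: supp_def)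
qed

text \<open>With a ramp of length \<open>3 * n\<close>, the window left after \<open>n\<close> calls
  runs from \<open>n\<close> to \<open>2 * n\<close>. It contains \<open>n\<close> whole
  differences, at each of which \<open>z\<close> has coefficient \<open>a / 2\<close> and the
  iterate has \<open>0\<close>.\<close>

lemma obj_ge:
  assumes X: "zero_respecting e p obj X"
    and z: "\<And>i. i \<le> 3 * n \<Longrightarrow> z \<bullet> e (prod_encode (b, i)) = a * (real (3 * n) - real i)"
  shows "real n * (\<bar>a / 2\<bar> ^ (p + 1) / fact (p + 1)) \<le> obj (X n)"
proof -
  let ?I = "(\<lambda>i. prod_encode (b, i)) ` {n..<2 * n}"
  have inj: "inj_on (\<lambda>i. prod_encode (b, i)) {n..<2 * n}" by (simp add: inj_on_def prod_encode_eq)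
  have "\<bar>a / 2\<bar> ^ (p + 1) / fact (p + 1)
      \<le> bregman p 0 (X n \<bullet> row_diff e m) (z \<bullet> row_diff e m)" if m: "m \<in> ?I" for m
  proof -
    obtain i where i: "m = prod_encode (b, i)" "n \<le> i" "i < 2 * n" using m by auto
    have "X n \<bullet> row_diff e m = 0"
      using zero_respecting_vanishes[OF X z, of n i] zero_respecting_vanishes[OF X z, of n "Suc i"] i
      by (simp add: row_diff_def inner_diff_right)
    moreover have "z \<bullet> row_diff e m = a / 2"
      using z[of i] z[of "Suc i"] i by (simp add: row_diff_def inner_diff_right algebra_simps)
    ultimately show ?thesis using bregman_0_at_0[OF p_pos, of "a / 2"] by (simp only:)
  qed
  then have "real (card ?I) * (\<bar>a / 2\<bar> ^ (p + 1) / fact (p + 1))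
      \<le> (\<Sum>m\<in>?I. bregman p 0 (X n \<bullet> row_diff e m) (z \<bullet> row_diff e m))"
    by (rule sum_bounded_below)
  also have "\<dots> \<le> obj (X n)"
    unfolding obj_def by (intro sum_le_suminf summable_obj) (auto simp: bregman_nonneg[OF p_pos])
  finally show ?thesis by (simp add: card_image[OF inj])
qed

end

section \<open>Construction of the minimiser from ramps\<close>

text \<open>The library versions of this fact require the class \<^class>\<open>banach\<close>, which the two classes
  \<^class>\<open>real_inner\<close> and \<^class>\<open>complete_space\<close> together do not imply for a type variable.\<close>

lemma summable_norm_dominated:
  fixes f :: "nat \<Rightarrow> 'a::{real_normed_vector, complete_space}"
  assumes "\<And>n. norm (f n) \<le> g n" "summable g"
  shows "summable f" "norm (suminf f) \<le> suminf g"
proof -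
  have "Cauchy (\<lambda>n. sum f {..<n})"
  proof (rule CauchyI')
    fix \<epsilon> :: real assume "0 < \<epsilon>"
    then obtain M where M: "\<And>m n. m \<ge> M \<Longrightarrow> norm (sum g {m..<n}) < \<epsilon>"
      using assms(2) unfolding summable_Cauchy by blast
    have "dist (sum f {..<m}) (sum f {..<n}) < \<epsilon>" if "m \<ge> M" "n > m" for m n
    proof -
      have "sum f {..<n} = sum f {..<m} + sum f {m..<n}"
        using that sum.atLeastLessThan_concat[of 0 m n f] by (simp add: atLeast0LessThan)
      then have "dist (sum f {..<m}) (sum f {..<n}) = norm (sum f {m..<n})" by (simp add: dist_norm)
      also have "\<dots> \<le> sum g {m..<n}" by (intro sum_norm_le assms(1))
      also have "\<dots> < \<epsilon>" using M[OF that(1), of n] by simp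
      finally show ?thesis .
    qed
    then show "\<exists>M. \<forall>m\<ge>M. \<forall>n>m. dist (sum f {..<m}) (sum f {..<n}) < \<epsilon>" by blast
  qed
  then show f: "summable f" by (simp add: summable_iff_convergent Cauchy_convergent_iff)
  have "(\<lambda>n. norm (sum f {..<n})) \<longlonglongrightarrow> norm (suminf f)"
    by (intro tendsto_norm summable_LIMSEQ f)
  moreover have "norm (sum f {..<n}) \<le> sum g {..<n}" for n by (intro sum_norm_le assms(1))
  ultimately show "norm (suminf f) \<le> suminf g"
    using summable_LIMSEQ[OF assms(2)] by (intro LIMSEQ_le) auto
qed

text \<open>A ramp has \<open>k b\<close> entries whose squares are at most \<open>1 / k b\<close>,
  so its norm is at most \<open>1\<close>; the weights \<open>(1 / 2) ^ Suc b\<close> sum to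
  \<open>1\<close>. Orthogonality of the rows keeps each ramp intact in the sum.\<close>

lemma exists_row_ramps:
  fixes e :: "nat \<Rightarrow> 'a::{real_inner, complete_space}" and k :: "nat \<Rightarrow> nat"
  assumes orth: "\<And>i j. e i \<bullet> e j = (if i = j then 1 else 0)"
    and k: "\<And>b. k b \<ge> 1"
  shows "\<exists>z. norm z \<le> 1 \<and> (\<forall>b i. i \<le> k b \<longrightarrow> z \<bullet> e (prod_encode (b, i))
    = (1 / 2) ^ Suc b * real (k b) powr (- 3 / 2) * (real (k b) - real i))"
proof -
  let ?c = "\<lambda>b i. real (k b) powr (- 3 / 2) * (real (k b) - real i)"
  define w where "w b = (\<Sum>i<k b. ?c b i *\<^sub>R e (prod_encode (b, i)))" for b
  define z where "z = (\<Sum>b. (1 / 2) ^ Suc b *\<^sub>R w b)"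
  have row: "e (prod_encode (b, i)) \<bullet> e (prod_encode (b, j)) = (if i = j then 1 else 0)" for b i j
    by (simp add: orth prod_encode_eq)
  have w_le: "norm (w b) \<le> 1" for b
  proof -
    have k0: "real (k b) > 0" using k[of b] by linarith
    have pw: "(real (k b) powr (- 3 / 2))\<^sup>2 = 1 / real (k b) ^ 3"
    proof -
      have "(real (k b) powr (- 3 / 2))\<^sup>2 = real (k b) powr (- 3)"
        using k0 by (subst powr_power) auto
      then show ?thesis using k0 by (simp add: powr_minus_divide)
    qed
    have "(?c b i)\<^sup>2 \<le> 1 / real (k b)" if "i < k b" for i
    proof -
      have "(real (k b) - real i)\<^sup>2 \<le> (real (k b))\<^sup>2" using that by (intro power_mono) auto
      then have "(?c b i)\<^sup>2 \<le> 1 / real (k b) ^ 3 * (real (k b))\<^sup>2"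
        unfolding power_mult_distrib pw by (rule mult_left_mono) simp
      also have "\<dots> = 1 / real (k b)" using k0 by (simp add: power2_eq_square power3_eq_cube)
      finally show ?thesis .
    qed
    then have "(\<Sum>i<k b. (?c b i)\<^sup>2) \<le> of_nat (card {..<k b}) * (1 / real (k b))"
      by (intro sum_bounded_above) auto
    then have "(norm (w b))\<^sup>2 \<le> 1"
      unfolding w_def norm_sum_orthonormal[of "\<lambda>i. e (prod_encode (b, i))", OF row] using k0 by simp
    then show ?thesis by (simp add: power2_le_iff_abs_le abs_square_le_1)
  qed
  have half: "summable (\<lambda>b. (1 / 2 :: real) ^ Suc b)" "(\<Sum>b. (1 / 2 :: real) ^ Suc b) = 1"
    using power_half_series by (auto simp: sums_iff)
  have term_le: "norm ((1 / 2) ^ Suc b *\<^sub>R w b) \<le> (1 / 2) ^ Suc b" for b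
    using mult_left_mono[OF w_le[of b], of "(1 / 2) ^ Suc b"] by (simp del: power_Suc)
  note w_sum = summable_norm_dominated[OF term_le half(1)]
  have "norm z \<le> 1" using w_sum(2) by (simp only: z_def half(2))
  moreover have "z \<bullet> e (prod_encode (b, i)) = (1 / 2) ^ Suc b * ?c b i" if "i \<le> k b" for b i
  proof -
    have w: "w b' \<bullet> e (prod_encode (b, i)) = (if b' = b then ?c b i else 0)" for b'
    proof (cases "b' = b")
      case True
      \<comment> \<open>The sum defining \<open>w b\<close> omits \<open>i = k b\<close>, where the
        ramp is \<open>0\<close> anyway.\<close>
      then show ?thesis
        unfolding w_def using inner_sum_orthonormal[of "\<lambda>i. e (prod_encode (b, i))", OF row] that
        by (cases "i = k b") auto
    next
      case False
      then show ?thesis by (simp add: w_def inner_sum_left orth prod_encode_eq)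
    qed
    have "(\<lambda>b'. ((1 / 2) ^ Suc b' *\<^sub>R w b') \<bullet> e (prod_encode (b, i))) sums (z \<bullet> e (prod_encode (b, i)))"
      unfolding z_def
      by (intro bounded_linear.sums[OF bounded_linear_inner_left] summable_sums w_sum(1))
    moreover have "(\<lambda>b'. ((1 / 2) ^ Suc b' *\<^sub>R w b') \<bullet> e (prod_encode (b, i)))
        = (\<lambda>b'. if b' = b then (1 / 2) ^ Suc b' * ?c b i else 0)"
      by (simp add: fun_eq_iff w del: power_Suc)
    ultimately show ?thesis
      using sums_single[of b "\<lambda>b'. (1 / 2) ^ Suc b' * ?c b i"] sums_unique2 by metis
  qed
  ultimately show ?thesis by (metis mult.assoc)
qed

section \<open>Choice of the horizons and the resulting lower bound\<close>

text \<open>Surjectivity yields a real point with a small value, and monotonicity carries the bound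
  to any larger integer.\<close>

lemma exists_nat_rho_le:
  fixes \<rho> :: "real \<Rightarrow> real"
  assumes bij: "bij_betw \<rho> {1..} {0<..1}" and anti: "antimono_on {1..} \<rho>" and "0 < \<epsilon>"
  shows "\<exists>n \<ge> N. \<rho> (real n) \<le> \<epsilon>"
proof -
  \<comment> \<open>Capping at \<open>1\<close> keeps the target value in the range of
    \<open>\<rho>\<close>.\<close>
  have "min \<epsilon> 1 \<in> \<rho> ` {1..}" using bij \<open>0 < \<epsilon>\<close> by (auto simp: bij_betw_def)
  then obtain x where x: "x \<ge> 1" "\<rho> x = min \<epsilon> 1" by auto
  define n where "n = max N (nat \<lceil>x\<rceil>)"
  have "x \<le> real n" unfolding n_def by linarith
  then have "\<rho> (real n) \<le> \<rho> x" using anti x(1) by (intro monotone_onD[OF anti]) auto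
  then show ?thesis using x(2) by (intro exI[of _ n]) (auto simp: n_def)
qed

theorem corollary2:
  fixes e :: "nat \<Rightarrow> 'a::{real_inner, complete_space}"
    and \<rho> :: "real \<Rightarrow> real"
    and p :: nat
  assumes "orthonormal_basis e"
    and "bij_betw \<rho> {1..} {0<..1}"
    and "antimono_on {1..} \<rho>"
    and "p \<ge> 1"
  shows "\<exists>F \<in> (smooth_convex_class p :: ('a \<Rightarrow> real) set).
    limsup (\<lambda>n. INF A\<in>zr_algorithms e p.
      ereal (real n powr ((3 * real p + 1) / 2) * (F (A F n) - opt_val F) / \<rho> (real n))) \<ge> 1"
proof -
  have orth: "e i \<bullet> e j = (if i = j then 1 else 0)" for i j
    using assms(1) by (simp add: orthonormal_basis_def)
  \<comment> \<open>For slope \<open>q * (3 * n) powr (- 3 / 2)\<close>, the divergence bound of one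
    difference is \<open>C * q ^ (p + 1) * n powr (- 3 / 2 * (p + 1))\<close>.\<close>
  define C :: real where "C = (3 powr (- 3 / 2) / 2) ^ (p + 1) / fact (p + 1)"
  have "0 < C * ((1 / 2) ^ Suc b) ^ (p + 1)" for b by (simp add: C_def del: fact_Suc)
  \<comment> \<open>The bound \<open>Suc b\<close> makes the horizons positive and unbounded. They
    are fixed before any algorithm is considered.\<close>
  then have "\<exists>n \<ge> Suc b. \<rho> (real n) \<le> C * ((1 / 2) ^ Suc b) ^ (p + 1)" for b
    by (intro exists_nat_rho_le assms)
  then obtain N where N: "\<And>b. N b \<ge> Suc b" "\<And>b. \<rho> (real (N b)) \<le> C * ((1 / 2) ^ Suc b) ^ (p + 1)"
    by metis
  have "3 * N b \<ge> 1" for b using N(1)[of b] by simp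
  from exists_row_ramps[of e "\<lambda>b. 3 * N b", OF orth this] obtain z where
    z: "norm z \<le> 1" "\<And>b i. i \<le> 3 * N b \<Longrightarrow> z \<bullet> e (prod_encode (b, i))
      = (1 / 2) ^ Suc b * real (3 * N b) powr (- 3 / 2) * (real (3 * N b) - real i)"
    by auto
  interpret bessel_system "row_diff e" by (rule bessel_system_row_diff[OF orth])
  interpret row_chain e p z by unfold_locales (use assms(4) orth in auto)
  have lower: "1 \<le> real (N b) powr ((3 * real p + 1) / 2) * (obj (A obj (N b)) - opt_val obj) / \<rho> (real (N b))"
    if A: "A \<in> zr_algorithms e p" for A b
  proof -
    let ?n = "real (N b)" and ?q = "(1 / 2 :: real) ^ Suc b"
    have n: "?n > 0" "?n \<ge> 1" using N(1)[of b] by linarith+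
    have \<rho>: "0 < \<rho> ?n" using bij_betwE[OF assms(2)] n by auto
    have "zero_respecting e p obj (A obj)"
      using A differentiable_through_obj by (simp add: zr_algorithms_def)
    from obj_ge[OF this z(2)]
    have "?n * (\<bar>?q * real (3 * N b) powr (- 3 / 2) / 2\<bar> ^ (p + 1) / fact (p + 1)) \<le> obj (A obj (N b))" .
    moreover have "\<bar>?q * real (3 * N b) powr (- 3 / 2) / 2\<bar> ^ (p + 1) / fact (p + 1)
        = C * ?q ^ (p + 1) * (?n powr (- 3 / 2)) ^ (p + 1)"
      by (simp add: C_def powr_mult power_mult_distrib power_divide abs_mult del: fact_Suc power_Suc)
    moreover have "(?n powr (- 3 / 2)) ^ (p + 1) = ?n powr (- 3 / 2 * real (p + 1))"
      using n by (subst powr_power) (auto simp: mult.commute)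
    ultimately have "?n * (C * ?q ^ (p + 1) * ?n powr (- 3 / 2 * real (p + 1))) \<le> obj (A obj (N b))"
      by (simp only:)
    then have "?n powr ((3 * real p + 1) / 2) * (?n * (C * ?q ^ (p + 1) * ?n powr (- 3 / 2 * real (p + 1))))
        \<le> ?n powr ((3 * real p + 1) / 2) * obj (A obj (N b))"
      by (rule mult_left_mono) simp
    \<comment> \<open>The \<open>n\<close> untouched differences supply the extra factor
      \<open>?n\<close> that balances the exponents.\<close>
    moreover have "?n powr ((3 * real p + 1) / 2) * (?n * ?n powr (- 3 / 2 * real (p + 1))) = 1"
    proof -
      have "?n powr ((3 * real p + 1) / 2) * (?n powr 1 * ?n powr (- 3 / 2 * real (p + 1)))
          = ?n powr ((3 * real p + 1) / 2 + (1 + - 3 / 2 * real (p + 1)))"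
        by (simp only: powr_add)
      also have "(3 * real p + 1) / 2 + (1 + - 3 / 2 * real (p + 1)) = 0" by (simp add: field_simps)
      finally show ?thesis using n by simp
    qed
    ultimately have "C * ?q ^ (p + 1) \<le> ?n powr ((3 * real p + 1) / 2) * obj (A obj (N b))"
      by (simp only: mult.left_commute[of _ "C * ?q ^ (p + 1)"] mult_1_right)
    then show ?thesis using N(2)[of b] \<rho> by (simp add: opt_val_obj le_divide_eq del: power_Suc)
  qed
  \<comment> \<open>The index \<open>N n\<close> lies beyond \<open>n\<close>, and
    \<open>lower\<close> holds there for all algorithms at once, hence for their infimum.\<close>
  have "1 \<le> (SUP m\<in>{n..}. INF A\<in>zr_algorithms e p.
      ereal (real m powr ((3 * real p + 1) / 2) * (obj (A obj m) - opt_val obj) / \<rho> (real m)))" for n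
    using N(1)[of n] by (intro SUP_upper2[of "N n"] INF_greatest) (auto simp: one_ereal_def intro: lower)
  then have "1 \<le> limsup (\<lambda>n. INF A\<in>zr_algorithms e p.
      ereal (real n powr ((3 * real p + 1) / 2) * (obj (A obj n) - opt_val obj) / \<rho> (real n)))"
    unfolding limsup_INF_SUP by (intro INF_greatest)
  then show ?thesis using obj_in_class[OF z(1)] by blast
qed

end
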